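(* Let $\Omega\subseteq\mathbb{R}^n$ be open and let $u\in C^2(\Omega)$ be a real-valued function such that $|Du|$ has no local minima in $\Omega$. For each nonempty open $\Omega'\Subset\Omega$ put $$\Omega'(u):=\Big\{x\in\overline{\Omega'}\ :\ |Du(x)|=\|Du\|_{L^\infty(\Omega')}\Big\}.$$ Let $\mathcal{A}^{\pm,\infty}_{\Omega'}(u)$ be the set consisting of all constant functions $\mathbb{R}^n\to\mathbb{R}$ together with all affine functions $A:\mathbb{R}^n\to\mathbb{R}$ for which there exist $\xi\in\mathbb{R}^{\pm}$, $x\in\Omega'(u)$ and $\mathbf{X}_x\in D^{2,\pm}u(x)$ such that $DA\equiv\xi\,\mathbf{X}_x\,Du(x)$. Let $\mathcal{A}^{\infty}_{\Omega'}(u)$ be the set of all affine functions $A:\mathbb{R}^n\to\mathbb{R}$ for which there exist $\xi\in\mathbb{R}$ and $x\in\Omega'(u)$ such that $A$ is parallel to the tangent of $\xi|Du|^2$ at $x$, i.e. $DA\equiv\xi\,D\big(|Du|^2\big)(x)$. Then the following three statements are equivalent: (1) $Du\otimes Du:D^2u=0$ on $\Omega$; (2) for all nonempty open $\Omega'\Subset\Omega$ and all $A\in\mathcal{A}^{+,\infty}_{\Omega'}(u)\cup\mathcal{A}^{-,\infty}_{\Omega'}(u)$, $\ \|Du\|_{L^\infty(\Omega')}\leq\|Du+DA\|_{L^\infty(\Omega')}$; (3) for all nonempty open $\Omega'\Subset\Omega$ and all $A\in\mathcal{A}^{\infty}_{\Omega'}(u)$, $\ \|Du\|_{L^\infty(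\Omega')}\leq\|Du+DA\|_{L^\infty(\Omega')}$.
   Context: $\mathbb{R}^+=[0,\infty)$, $\mathbb{R}^-=(-\infty,0]$; $\mathbb{R}^{n^2}_s$ is the space of symmetric $n\times n$ real matrices; $|\cdot|$ is the Euclidean norm; $Du\otimes Du:D^2u=\sum_{i,j}D_iu\,D_ju\,D^2_{ij}u$; $\Omega'\Subset\Omega$ means that $\overline{\Omega'}$ is compact and contained in $\Omega$; $\|Du\|_{L^\infty(\Omega')}=\operatorname{ess\,sup}_{\Omega'}|Du|$. For $x\in\Omega$, $J_0^{2,+}u(x)$ (resp. $J_0^{2,-}u(x)$) is the set of all $(P,\mathbf{X})\in(\mathbb{R}^n\setminus\{0\})\times\mathbb{R}^{n^2}_s$ such that $$u(z+x)\le\ (\text{resp. }\ge)\ \ u(x)+P\cdot z+\tfrac12\mathbf{X}:z\otimes z+o(|z|^2)\quad\text{as }z\to0,$$ and $D^{2,\pm}u(x):=\{\mathbf{X}\in\mathbb{R}^{n^2}_s:\ (Du(x),\mathbf{X})\in J_0^{2,\pm}u(x)\}$. *)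

theory Defs
  imports "HOL-Analysis.Analysis" "HOL-Probability.Essential_Supremum"
    "HOL-Library.Landau_Symbols"
begin

subsection \<open>Gradient, Hessian and the class \<open>C\<^sup>2\<close>\<close>

definition grad :: "(real^'n \<Rightarrow> real) \<Rightarrow> real^'n \<Rightarrow> real^'n" where
  "grad f x = (\<chi> i. frechet_derivative f (at x) (axis i 1))"

definition hess :: "(real^'n \<Rightarrow> real) \<Rightarrow> real^'n \<Rightarrow> real^'n^'n" where
  "hess f x = jacobian (grad f) (at x)"

definition C2_on :: "(real^'n) set \<Rightarrow> (real^'n \<Rightarrow> real) \<Rightarrow> bool" where
  "C2_on \<Omega> f \<longleftrightarrow>
     (\<forall>x\<in>\<Omega>. f differentiable (at x)) \<and>
     (\<forall>x\<in>\<Omega>. grad f differentiable (at x)) \<and>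
     continuous_on \<Omega> (hess f)"

lemma GDERIV_grad:
  assumes "f differentiable (at x)"
  shows "GDERIV f x :> grad f x"
proof -
  let ?D = "frechet_derivative f (at x)"
  have D: "(f has_derivative ?D) (at x)"
    using assms by (simp add: frechet_derivative_works)
  then interpret linear ?D by (rule has_derivative_linear)
  have "?D h = h \<bullet> grad f x" for h
  proof -
    have "?D h = ?D (\<Sum>i\<in>UNIV. h $ i *\<^sub>R axis i 1)"
      using basis_expansion[of h] by (simp add: scalar_mult_eq_scaleR)
    also have "\<dots> = (\<Sum>i\<in>UNIV. h $ i * ?D (axis i 1))"
      by (simp add: sum scaleR)
    finally show ?thesis by (simp add: grad_def inner_vec_def)
  qed
  then have "?D = (\<lambda>h. h \<bullet> grad f x)" by blast
  then show ?thesis using D by (simp add: gderiv_def)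
qed

text \<open>Tensor product of vectors. The contraction \<open>X : Y\<close> of matrices is the inner product
  \<open>X \<bullet> Y\<close> of the type \<^typ>\<open>real^'n^'n\<close>, i.e. the sum of all \<open>X $ i $ j * Y $ i $ j\<close>.\<close>

definition tensor :: "real^'n \<Rightarrow> real^'n \<Rightarrow> real^'n^'n" where
  "tensor v w = (\<chi> i j. v $ i * w $ j)"

text \<open>Local minima are not required to be strict.\<close>

definition local_min_in :: "'a::topological_space set \<Rightarrow> ('a \<Rightarrow> real) \<Rightarrow> 'a \<Rightarrow> bool" where
  "local_min_in S f x \<longleftrightarrow> x \<in> S \<and> (\<forall>\<^sub>F y in at x within S. f x \<le> f y)"

definition affine_fun :: "(real^'n \<Rightarrow> real) \<Rightarrow> bool" where
  "affine_fun A \<longleftrightarrow> (\<exists>L c. linear L \<and> A = (\<lambda>x. L x + c))"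

subsection \<open>The supremal norm\<close>

definition compactly_inside :: "'a::topological_space set \<Rightarrow> 'a set \<Rightarrow> bool" where
  "compactly_inside S \<Omega> \<longleftrightarrow> compact (closure S) \<and> closure S \<subseteq> \<Omega>"

definition Linf_norm :: "(real^'n) set \<Rightarrow> (real^'n \<Rightarrow> real^'n) \<Rightarrow> ereal" where
  "Linf_norm S F = esssup (lebesgue_on S) (\<lambda>x. ereal (norm (F x)))"

text \<open>The set written \<open>\<Omega>'(u)\<close> for \<open>S = \<Omega>'\<close>.\<close>

definition max_set :: "(real^'n) set \<Rightarrow> (real^'n \<Rightarrow> real) \<Rightarrow> (real^'n) set" where
  "max_set S u = {x \<in> closure S. ereal (norm (grad u x)) = Linf_norm S (grad u)}"

subsection \<open>Semijets with nonzero first-order part\<close>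

text \<open>The remainder inequality is imposed in the punctured filter \<^term>\<open>at 0\<close>: at \<open>z = 0\<close> it
  carries no information.\<close>

definition semijet_plus :: "(real^'n \<Rightarrow> real) \<Rightarrow> real^'n \<Rightarrow> ((real^'n) \<times> (real^'n^'n)) set" where
  "semijet_plus u x = {(P, X). P \<noteq> 0 \<and> transpose X = X \<and>
     (\<exists>r. r \<in> o[at 0](\<lambda>z. (norm z)\<^sup>2) \<and>
       (\<forall>\<^sub>F z in at 0. u (z + x) \<le> u x + P \<bullet> z + 1/2 * (X \<bullet> tensor z z) + r z))}"

definition semijet_minus :: "(real^'n \<Rightarrow> real) \<Rightarrow> real^'n \<Rightarrow> ((real^'n) \<times> (real^'n^'n)) set" where
  "semijet_minus u x = {(P, X). P \<noteq> 0 \<and> transpose X = X \<and>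
     (\<exists>r. r \<in> o[at 0](\<lambda>z. (norm z)\<^sup>2) \<and>
       (\<forall>\<^sub>F z in at 0. u (z + x) \<ge> u x + P \<bullet> z + 1/2 * (X \<bullet> tensor z z) + r z))}"

definition D2_plus :: "(real^'n \<Rightarrow> real) \<Rightarrow> real^'n \<Rightarrow> (real^'n^'n) set" where
  "D2_plus u x = {X. (grad u x, X) \<in> semijet_plus u x}"

definition D2_minus :: "(real^'n \<Rightarrow> real) \<Rightarrow> real^'n \<Rightarrow> (real^'n^'n) set" where
  "D2_minus u x = {X. (grad u x, X) \<in> semijet_minus u x}"

subsection \<open>Classes of affine variations\<close>

definition aff_plus :: "(real^'n) set \<Rightarrow> (real^'n \<Rightarrow> real) \<Rightarrow> (real^'n \<Rightarrow> real) set" where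
  "aff_plus S u = {A. \<exists>c. A = (\<lambda>_. c)} \<union>
     {A. affine_fun A \<and> (\<exists>\<xi> x X. \<xi> \<ge> 0 \<and> x \<in> max_set S u \<and> X \<in> D2_plus u x \<and>
            (\<forall>y. grad A y = \<xi> *\<^sub>R (X *v grad u x)))}"

definition aff_minus :: "(real^'n) set \<Rightarrow> (real^'n \<Rightarrow> real) \<Rightarrow> (real^'n \<Rightarrow> real) set" where
  "aff_minus S u = {A. \<exists>c. A = (\<lambda>_. c)} \<union>
     {A. affine_fun A \<and> (\<exists>\<xi> x X. \<xi> \<le> 0 \<and> x \<in> max_set S u \<and> X \<in> D2_minus u x \<and>
            (\<forall>y. grad A y = \<xi> *\<^sub>R (X *v grad u x)))}"

definition aff_tangent :: "(real^'n) set \<Rightarrow> (real^'n \<Rightarrow> real) \<Rightarrow> (real^'n \<Rightarrow> real) set" where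
  "aff_tangent S u =
     {A. affine_fun A \<and> (\<exists>\<xi> x. x \<in> max_set S u \<and>
            (\<forall>y. grad A y = \<xi> *\<^sub>R grad (\<lambda>z. (norm (grad u z))\<^sup>2) x))}"

end

theory Submission
  imports Defs
begin

text \<open>
  If \<open>|Du|\<close> attains its maximum over the closure of \<open>\<Omega>'\<close> at \<open>x\<close> and \<open>Du(x) \<bullet> a \<ge> 0\<close>, then
  \<open>|Du(x) + a| \<ge> |Du(x)|\<close>. For the admissible \<open>a\<close> the product \<open>Du(x) \<bullet> a\<close> has the sign of a
  multiple of \<open>X : Du \<otimes> Du\<close>, and elements \<open>X\<close> of the semijets lie above or below the Hessian as
  quadratic forms, so the PDE implies the variational inequalities.

  Conversely, if \<open>Du \<otimes> Du : D\<^sup>2u \<noteq> 0\<close> at \<open>x\<close>, take for \<open>\<Omega>'\<close> the set of points \<open>y\<close> near \<open>x\<close> with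
  \<open>|Du(y)| < |Du(x)|\<close>. As \<open>x\<close> is not a local minimum of \<open>|Du|\<close>, it lies in the closure of \<open>\<Omega>'\<close> and is
  a maximum point there. A small multiple \<open>a\<close> of \<open>D\<^sup>2u(x) Du(x)\<close> with \<open>Du(x) \<bullet> a < 0\<close> lowers the
  supremum of the gradient. Replacing the Hessian by its symmetric part makes Schwarz's theorem
  unnecessary.
\<close>

subsection \<open>The supremal norm of continuous fields\<close>

text \<open>A value above the norm would persist on a neighbourhood of \<open>x\<close>, which meets
  \<open>S\<close> in a nonempty open set because \<open>x\<close> lies in the closure; such a set
  is not null. Boundary points of \<open>S\<close> are thus covered.\<close>

lemma norm_le_Linf_norm:
  fixes F :: "real^'n \<Rightarrow> real^'n"
  assumes "open \<Omega>" "continuous_on \<Omega> F" "open S" "S \<subseteq> \<Omega>" "x \<in> closure S" "x \<in> \<Omega>"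
  shows "ereal (norm (F x)) \<le> Linf_norm S F"
proof (rule ccontr)
  define L where "L = Linf_norm S F"
  define f where "f y = ereal (norm (F y))" for y
  assume "\<not> ?thesis"
  then have Lx: "L < f x" by (simp add: L_def f_def)
  have "continuous_on \<Omega> f"
    unfolding f_def by (intro continuous_intros assms)
  then have op: "open (\<Omega> \<inter> f -` {L<..})"
    using \<open>open \<Omega>\<close> by (intro continuous_open_preimage) auto
  have "x \<in> \<Omega> \<inter> f -` {L<..}" using Lx assms by auto
  then have ne: "S \<inter> (\<Omega> \<inter> f -` {L<..}) \<noteq> {}"
    using op assms(5) by (metis closure_iff_nhds_not_empty Int_commute order_refl)
  have "AE y in lebesgue_on S. f y \<le> L"
    unfolding L_def Linf_norm_def f_def by (rule esssup_AE)
  then have "AE y in lebesgue. y \<in> S \<longrightarrow> f y \<le> L"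
    using \<open>open S\<close> by (simp add: AE_restrict_space_iff)
  then obtain N where "N \<in> null_sets lebesgue" and N: "{y \<in> space lebesgue. \<not> (y \<in> S \<longrightarrow> f y \<le> L)} \<subseteq> N"
    unfolding eventually_ae_filter by blast
  then have "negligible N" by (simp add: negligible_iff_null_sets)
  moreover have "S \<inter> (\<Omega> \<inter> f -` {L<..}) \<subseteq> N"
    using N by auto
  ultimately have "negligible (S \<inter> (\<Omega> \<inter> f -` {L<..}))"
    by (rule negligible_subset)
  then show False
    using open_not_negligible[OF open_Int[OF \<open>open S\<close> op] ne] by blast
qed

lemma Linf_norm_le:
  fixes F :: "real^'n \<Rightarrow> real^'n"
  assumes "open S" "continuous_on S F" "\<And>y. y \<in> S \<Longrightarrow> norm (F y) \<le> c"
  shows "Linf_norm S F \<le> ereal c"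
  unfolding Linf_norm_def
proof (rule esssup_I)
  \<comment> \<open>\<open>esssup\<close> takes the value top on non-measurable functions, so the
    pointwise estimate alone does not bound it.\<close>
  show "(\<lambda>x. ereal (norm (F x))) \<in> borel_measurable (lebesgue_on S)"
    using assms by (intro continuous_imp_measurable_on_sets_lebesgue continuous_intros) auto
  show "AE x in lebesgue_on S. ereal (norm (F x)) \<le> ereal c"
    using assms(3) by (intro AE_I2) (simp add: space_restrict_space)
qed

text \<open>Let \<open>S\<close> be the part of a small ball where
  \<open>norm (F y) < norm (F x)\<close>. Expanding the squared norm of
  \<open>F y + s *\<^sub>R v\<close> there gives a negative linear term in \<open>s\<close>, which
  dominates the quadratic one for small \<open>s\<close>.\<close>

lemma Linf_norm_decrease:
  fixes F :: "real^'n \<Rightarrow> real^'n"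
  assumes "open \<Omega>" "continuous_on \<Omega> F" "x \<in> \<Omega>"
    and nm: "\<not> local_min_in \<Omega> (\<lambda>y. norm (F y)) x"
    and neg: "F x \<bullet> v < 0"
  obtains S s where "open S" "S \<noteq> {}" "compactly_inside S \<Omega>" "x \<in> closure S"
    "Linf_norm S F = ereal (norm (F x))" "0 < s"
    "Linf_norm S (\<lambda>y. F y + s *\<^sub>R v) < ereal (norm (F x))"
proof -
  define b where "b = - (F x \<bullet> v)"
  have b: "b > 0" using neg by (simp add: b_def)
  have "continuous_on \<Omega> (\<lambda>y. F y \<bullet> v)" by (intro continuous_intros assms)
  \<comment> \<open>Half of the value at \<open>x\<close> is kept as a margin that is uniform on a
    ball.\<close>
  then have "open (\<Omega> \<inter> (\<lambda>y. F y \<bullet> v) -` {..< - b / 2})"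
    using \<open>open \<Omega>\<close> by (intro continuous_open_preimage) auto
  moreover have "x \<in> \<Omega> \<inter> (\<lambda>y. F y \<bullet> v) -` {..< - b / 2}"
    using b \<open>x \<in> \<Omega>\<close> by (simp add: b_def)
  ultimately obtain r where r: "r > 0" and sub: "cball x r \<subseteq> \<Omega> \<inter> (\<lambda>y. F y \<bullet> v) -` {..< - b / 2}"
    using open_contains_cball by metis
  define S where "S = ball x r \<inter> (\<Omega> \<inter> (\<lambda>y. norm (F y)) -` {..< norm (F x)})"
  have "continuous_on \<Omega> (\<lambda>y. norm (F y))" by (intro continuous_intros assms)
  then have S: "open S"
    unfolding S_def using \<open>open \<Omega>\<close> by (intro open_Int open_ball continuous_open_preimage) auto
  have Ssub: "S \<subseteq> ball x r" "S \<subseteq> \<Omega>" by (auto simp: S_def)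
  then have cl: "closure S \<subseteq> cball x r"
    using ball_subset_cball[of x r] by (intro closure_minimal) auto
  have ci: "compactly_inside S \<Omega>"
    unfolding compactly_inside_def using cl sub
    by (meson Int_subset_iff bounded_cball bounded_subset closed_closure compact_eq_bounded_closed order_trans)
  \<comment> \<open>If some neighbourhood of \<open>x\<close> missed \<open>S\<close>, then
    \<open>norm (F y)\<close> would be at least \<open>norm (F x)\<close> near \<open>x\<close>,
    making \<open>x\<close> a local minimum.\<close>
  have near: "\<exists>y\<in>S. dist y x < e" if "e > 0" for e
  proof (rule ccontr)
    assume *: "\<not> ?thesis"
    have "\<forall>\<^sub>F y in at x within \<Omega>. norm (F x) \<le> norm (F y)"
      unfolding eventually_at
    proof (intro exI[of _ "min e r"] conjI ballI impI)
      fix y assume "y \<in> \<Omega>" "y \<noteq> x \<and> dist y x < min e r"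
      then show "norm (F x) \<le> norm (F y)"
        using * by (force simp: S_def dist_commute)
    qed (use that r in auto)
    then show False using nm \<open>x \<in> \<Omega>\<close> by (simp add: local_min_in_def)
  qed
  then have xcl: "x \<in> closure S" by (simp add: closure_approachable)
  have ne: "S \<noteq> {}" using near[of 1] by auto
  have contS: "continuous_on S F" using assms(2) Ssub(2) continuous_on_subset by blast
  have eq: "Linf_norm S F = ereal (norm (F x))"
  proof (rule antisym)
    show "Linf_norm S F \<le> ereal (norm (F x))"
      by (rule Linf_norm_le[OF S contS]) (auto simp: S_def)
    show "ereal (norm (F x)) \<le> Linf_norm S F"
      using norm_le_Linf_norm[OF assms(1,2) S Ssub(2) xcl \<open>x \<in> \<Omega>\<close>] .
  qed
  \<comment> \<open>With this size the quadratic term is at most \<open>s * b / 2\<close>, half of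
    the decrease \<open>s * b\<close> given by the linear term; the \<open>+ 1\<close> keeps the
    denominator positive.\<close>
  define s where "s = b / (2 * ((norm v)\<^sup>2 + 1))"
  have pos: "(norm v)\<^sup>2 + 1 > 0" by (simp add: add_nonneg_pos)
  have s: "s > 0" using b pos by (simp add: s_def)
  have "s * (2 * ((norm v)\<^sup>2 + 1)) = b" using pos by (simp add: s_def)
  then have "s * (norm v)\<^sup>2 \<le> b / 2" using s by (simp add: algebra_simps)
  then have sv: "s\<^sup>2 * (norm v)\<^sup>2 \<le> s * b / 2"
    using mult_left_mono[of "s * (norm v)\<^sup>2" "b / 2" s] s by (simp add: power2_eq_square mult_ac)
  \<comment> \<open>A single bound for all of \<open>S\<close>: pointwise strict inequalities alone
    would still allow equality of the suprema.\<close>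
  define K where "K = (norm (F x))\<^sup>2 - s * b / 2"
  have bound: "norm (F y + s *\<^sub>R v) \<le> sqrt K" if "y \<in> S" for y
  proof (rule real_le_rsqrt)
    have "y \<in> cball x r" using that Ssub by auto
    then have "F y \<bullet> v \<le> - b / 2" using sub by auto
    then have 1: "2 * s * (F y \<bullet> v) \<le> - (s * b)"
      using mult_left_mono[of "F y \<bullet> v" "- b / 2" "2 * s"] s by simp
    have "norm (F y) \<le> norm (F x)" using that by (simp add: S_def)
    then have 2: "(norm (F y))\<^sup>2 \<le> (norm (F x))\<^sup>2" by (simp add: power_mono)
    have "(norm (F y + s *\<^sub>R v))\<^sup>2 = (norm (F y))\<^sup>2 + 2 * s * (F y \<bullet> v) + s\<^sup>2 * (norm v)\<^sup>2"
      using dot_norm[of "F y" "s *\<^sub>R v"] by (simp add: power_mult_distrib)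
    then show "(norm (F y + s *\<^sub>R v))\<^sup>2 \<le> K" using 1 2 sv unfolding K_def by linarith
  qed
  have "Linf_norm S (\<lambda>y. F y + s *\<^sub>R v) \<le> ereal (sqrt K)"
    by (rule Linf_norm_le[OF S _ bound]) (auto intro!: continuous_intros contS)
  also have "ereal (sqrt K) < ereal (norm (F x))"
  proof -
    have "K < (norm (F x))\<^sup>2" using s b by (simp add: K_def)
    then have "sqrt K < sqrt ((norm (F x))\<^sup>2)" by (rule real_sqrt_less_mono)
    then show ?thesis by simp
  qed
  finally show ?thesis using that S ne ci xcl eq s by blast
qed

subsection \<open>Quadratic forms and second-order expansions\<close>

lemma inner_tensor: "X \<bullet> tensor v w = v \<bullet> (X *v w)"
  by (simp add: tensor_def inner_vec_def matrix_vector_mult_def sum_distrib_left mult_ac)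

lemma inner_tensor_scaleR: "X \<bullet> tensor (t *\<^sub>R z) (t *\<^sub>R z) = t\<^sup>2 * (X \<bullet> tensor z z)"
  by (simp add: inner_tensor matrix_vector_mult_scaleR power2_eq_square)

text \<open>Supplies the matrix that the semijets ask for: symmetric, yet with the same quadratic
  form as \<open>H\<close>.\<close>

definition sym_part :: "real^'n^'n \<Rightarrow> real^'n^'n" where
  "sym_part H = (1/2) *\<^sub>R (H + transpose H)"

lemma transpose_sym_part: "transpose (sym_part H) = sym_part H"
  by (simp add: sym_part_def transpose_def vec_eq_iff add.commute)

lemma inner_sym_part_tensor: "sym_part H \<bullet> tensor z z = H \<bullet> tensor z z"
proof -
  have "transpose H \<bullet> tensor z z = H \<bullet> tensor z z"
    by (metis dot_lmul_matrix inner_commute inner_tensor transpose_matrix_vector)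
  then show ?thesis by (simp add: sym_part_def inner_add_left)
qed

text \<open>Peano form of the remainder: the mean value theorem on the segment from \<open>x\<close>
  to \<open>z + x\<close> turns the first-order expansion of the gradient at \<open>x\<close> into
  the second-order expansion of \<open>u\<close>.\<close>

lemma taylor2_smallo:
  fixes u :: "real^'n \<Rightarrow> real"
  assumes "open \<Omega>" "x \<in> \<Omega>" "\<And>y. y \<in> \<Omega> \<Longrightarrow> u differentiable (at y)" "grad u differentiable (at x)"
  shows "(\<lambda>z. u (z + x) - u x - grad u x \<bullet> z - 1/2 * (hess u x \<bullet> tensor z z))
           \<in> o[at 0](\<lambda>z. (norm z)\<^sup>2)"
proof (rule landau_o.smallI)
  fix e :: real assume "e > 0"
  let ?H = "hess u x"
  have "(grad u has_derivative (\<lambda>h. ?H *v h)) (at x)"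
    using assms(4) jacobian_works unfolding hess_def by blast
  then obtain d where d: "d > 0"
    and est: "\<And>y. norm (y - x) < d \<Longrightarrow> norm (grad u y - grad u x - ?H *v (y - x)) \<le> e * norm (y - x)"
    using \<open>e > 0\<close> unfolding has_derivative_at_alt by blast
  obtain d' where d': "d' > 0" "ball x d' \<subseteq> \<Omega>"
    using assms(1,2) open_contains_ball by blast
  have "norm (u (z + x) - u x - grad u x \<bullet> z - 1/2 * (?H \<bullet> tensor z z)) \<le> e * norm ((norm z)\<^sup>2)"
    if z: "norm z < min d d'" for z
  proof -
    \<comment> \<open>\<open>\<phi>\<close> is \<open>u\<close> along the segment minus the linear
      and quadratic Taylor terms; its derivative \<open>\<psi>\<close> pairs \<open>z\<close> with
      the first-order remainder of the gradient.\<close>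
    define \<phi> where "\<phi> t = u (x + t *\<^sub>R z) - t * (grad u x \<bullet> z) - t\<^sup>2 / 2 * (z \<bullet> (?H *v z))" for t
    define \<psi> where "\<psi> t = z \<bullet> (grad u (x + t *\<^sub>R z) - grad u x - ?H *v (t *\<^sub>R z))" for t
    have le: "norm (t *\<^sub>R z) \<le> norm z" if "0 \<le> t" "t \<le> 1" for t
      using that by (simp add: mult_left_le_one_le)
    have "(\<phi> has_real_derivative \<psi> t) (at t)" if t: "0 \<le> t" "t \<le> 1" for t
    proof -
      have "x + t *\<^sub>R z \<in> \<Omega>" using le[OF t] z d'(2) by (auto simp: dist_norm)
      then have "GDERIV u (x + t *\<^sub>R z) :> grad u (x + t *\<^sub>R z)"
        using assms(3) GDERIV_grad by blast
      then have "(u has_derivative (\<lambda>h. h \<bullet> grad u (x + t *\<^sub>R z))) (at (x + t *\<^sub>R z))"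
        by (simp add: gderiv_def)
      then have "((\<lambda>t. u (x + t *\<^sub>R z)) has_derivative (\<lambda>h. (h *\<^sub>R z) \<bullet> grad u (x + t *\<^sub>R z))) (at t)"
        by (rule has_derivative_compose[rotated]) (auto intro!: derivative_eq_intros)
      then have "((\<lambda>t. u (x + t *\<^sub>R z)) has_real_derivative z \<bullet> grad u (x + t *\<^sub>R z)) (at t)"
        by (simp add: has_field_derivative_def mult_commute_abs)
      then show ?thesis
        unfolding \<phi>_def \<psi>_def
        by (auto intro!: derivative_eq_intros
            simp: inner_diff_right matrix_vector_mult_scaleR inner_commute)
    qed
    then obtain t where t: "0 < t" "t < 1" and eq: "\<phi> 1 - \<phi> 0 = \<psi> t"
      using MVT2[of 0 1 \<phi> \<psi>] by auto
    have "\<bar>\<psi> t\<bar> \<le> norm z * norm (grad u (x + t *\<^sub>R z) - grad u x - ?H *v (t *\<^sub>R z))"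
      unfolding \<psi>_def by (rule Cauchy_Schwarz_ineq2)
    also have "\<dots> \<le> norm z * (e * norm (t *\<^sub>R z))"
      using est[of "x + t *\<^sub>R z"] le[of t] t z by (intro mult_left_mono) auto
    also have "\<dots> \<le> norm z * (e * norm z)"
      using le[of t] t \<open>e > 0\<close> by (intro mult_left_mono) auto
    finally have "\<bar>\<phi> 1 - \<phi> 0\<bar> \<le> e * (norm z)\<^sup>2"
      unfolding eq by (simp add: power2_eq_square mult_ac)
    moreover have "\<phi> 1 - \<phi> 0 = u (z + x) - u x - grad u x \<bullet> z - 1/2 * (?H \<bullet> tensor z z)"
      by (simp add: \<phi>_def inner_tensor add.commute)
    ultimately show ?thesis by simp
  qed
  then show "\<forall>\<^sub>F z in at 0. norm (u (z + x) - u x - grad u x \<bullet> z - 1/2 * (?H \<bullet> tensor z z))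
      \<le> e * norm ((norm z)\<^sup>2)"
    unfolding eventually_at by (intro exI[of _ "min d d'"]) (use d d' in auto)
qed

text \<open>On the ray through \<open>p\<close> the form scales exactly like t^2, so a remainder of
  smaller order cannot compensate a negative value.\<close>

lemma quadratic_nonneg_of_smallo:
  fixes Y :: "real^'n^'n"
  assumes r: "r \<in> o[at 0](\<lambda>z. (norm z)\<^sup>2)"
    and ev: "\<forall>\<^sub>F z in at 0. 0 \<le> Y \<bullet> tensor z z + r z"
  shows "0 \<le> Y \<bullet> tensor p p"
proof (rule ccontr)
  define c where "c = - (Y \<bullet> tensor p p)"
  assume "\<not> ?thesis"
  then have c: "c > 0" by (simp add: c_def)
  then have p: "p \<noteq> 0" by (auto simp: c_def inner_tensor)
  \<comment> \<open>Then \<open>e * (norm p)\<^sup>2\<close> is \<open>c / 2\<close>, so the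
    remainder offsets at most half of the negative value.\<close>
  define e where "e = c / (2 * (norm p)\<^sup>2)"
  have "e > 0" using c p by (simp add: e_def)
  then have "\<forall>\<^sub>F z in at 0. norm (r z) \<le> e * norm ((norm z)\<^sup>2)"
    using r by (rule landau_o.smallD[rotated])
  with ev have "\<forall>\<^sub>F z in at 0. 0 \<le> Y \<bullet> tensor z z + e * (norm z)\<^sup>2"
    by eventually_elim auto
  then obtain d where d: "d > 0"
    and D: "\<And>z. z \<noteq> 0 \<Longrightarrow> norm z < d \<Longrightarrow> 0 \<le> Y \<bullet> tensor z z + e * (norm z)\<^sup>2"
    unfolding eventually_at by auto
  \<comment> \<open>This gives \<open>t *\<^sub>R p\<close> the norm \<open>d / 2\<close>, inside
    the ball where the inequality holds.\<close>
  define t where "t = d / (2 * norm p)"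
  have t: "t > 0" using d p by (simp add: t_def)
  have "0 \<le> Y \<bullet> tensor (t *\<^sub>R p) (t *\<^sub>R p) + e * (norm (t *\<^sub>R p))\<^sup>2"
    using t p d by (intro D) (simp_all add: t_def)
  also have "\<dots> = t\<^sup>2 * (- c) + e * (t\<^sup>2 * (norm p)\<^sup>2)"
    unfolding inner_tensor_scaleR by (simp add: c_def power_mult_distrib)
  also have "\<dots> = - (t\<^sup>2 * c / 2)" using p by (simp add: e_def field_simps)
  also have "\<dots> < 0" using t c by simp
  finally show False by simp
qed

section \<open>Computing gradients, and affine functions with prescribed gradient\<close>

lemma grad_eqI:
  assumes "(f has_derivative (\<lambda>h. h \<bullet> g)) (at x)"
  shows "grad f x = g"
  by (simp add: grad_def vec_eq_iff inner_axis' flip: frechet_derivative_at[OF assms])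

lemma grad_inner: "grad (\<lambda>y. y \<bullet> a) x = a"
  by (rule grad_eqI) (auto intro!: derivative_eq_intros)

lemma affine_fun_inner: "affine_fun (\<lambda>y. y \<bullet> a)"
  unfolding affine_fun_def
  by (intro exI[of _ "\<lambda>y. y \<bullet> a"] exI[of _ 0]) (auto intro!: bounded_linear.linear bounded_linear_inner_left)

section \<open>A \<open>C2\<close> function: semijets, then the estimates for both
  directions\<close>

context
  fixes \<Omega> :: "(real^'n) set" and u :: "real^'n \<Rightarrow> real"
  assumes open_dom: "open \<Omega>" and C2: "C2_on \<Omega> u"
begin

lemma continuous_on_grad: "continuous_on \<Omega> (grad u)"
  using C2 unfolding C2_on_def
  by (intro differentiable_imp_continuous_on) (simp add: differentiable_on_def differentiable_at_withinI)

lemma taylor2_C2: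
  assumes "x \<in> \<Omega>"
  shows "(\<lambda>z. u (z + x) - u x - grad u x \<bullet> z - 1/2 * (hess u x \<bullet> tensor z z))
           \<in> o[at 0](\<lambda>z. (norm z)\<^sup>2)"
  using taylor2_smallo[OF open_dom assms] C2 assms unfolding C2_on_def by blast

text \<open>Subtracting the Taylor expansion from the semijet inequality cancels the value and the
  gradient term; half the form of \<open>X - hess u x\<close> is then nonnegative up to
  o(|z|^2).\<close>

lemma D2_plus_ge_hess:
  assumes "x \<in> \<Omega>" "X \<in> D2_plus u x"
  shows "hess u x \<bullet> tensor p p \<le> X \<bullet> tensor p p"
proof -
  obtain r where r: "r \<in> o[at 0](\<lambda>z. (norm z)\<^sup>2)"
    and ev: "\<forall>\<^sub>F z in at 0. u (z + x) \<le> u x + grad u x \<bullet> z + 1/2 * (X \<bullet> tensor z z) + r z"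
    using assms(2) unfolding D2_plus_def semijet_plus_def by blast
  let ?q = "\<lambda>z. u (z + x) - u x - grad u x \<bullet> z - 1/2 * (hess u x \<bullet> tensor z z)"
  have "0 \<le> ((1/2) *\<^sub>R (X - hess u x)) \<bullet> tensor p p"
  proof (rule quadratic_nonneg_of_smallo)
    show "(\<lambda>z. r z - ?q z) \<in> o[at 0](\<lambda>z. (norm z)\<^sup>2)"
      by (rule sum_in_smallo(2)[OF r taylor2_C2[OF assms(1)]])
    show "\<forall>\<^sub>F z in at 0. 0 \<le> ((1/2) *\<^sub>R (X - hess u x)) \<bullet> tensor z z + (r z - ?q z)"
      using ev by eventually_elim (simp add: inner_diff_left algebra_simps)
  qed
  then show ?thesis by (simp add: inner_diff_left)
qed

text \<open>Mirror image of \<open>D2_plus_ge_hess\<close>: the difference and the remainder change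
  sign.\<close>

lemma D2_minus_le_hess:
  assumes "x \<in> \<Omega>" "X \<in> D2_minus u x"
  shows "X \<bullet> tensor p p \<le> hess u x \<bullet> tensor p p"
proof -
  obtain r where r: "r \<in> o[at 0](\<lambda>z. (norm z)\<^sup>2)"
    and ev: "\<forall>\<^sub>F z in at 0. u (z + x) \<ge> u x + grad u x \<bullet> z + 1/2 * (X \<bullet> tensor z z) + r z"
    using assms(2) unfolding D2_minus_def semijet_minus_def by blast
  let ?q = "\<lambda>z. u (z + x) - u x - grad u x \<bullet> z - 1/2 * (hess u x \<bullet> tensor z z)"
  have "0 \<le> ((1/2) *\<^sub>R (hess u x - X)) \<bullet> tensor p p"
  proof (rule quadratic_nonneg_of_smallo)
    show "(\<lambda>z. ?q z - r z) \<in> o[at 0](\<lambda>z. (norm z)\<^sup>2)"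
      by (rule sum_in_smallo(2)[OF taylor2_C2[OF assms(1)] r])
    show "\<forall>\<^sub>F z in at 0. 0 \<le> ((1/2) *\<^sub>R (hess u x - X)) \<bullet> tensor z z + (?q z - r z)"
      using ev by eventually_elim (simp add: inner_diff_left algebra_simps)
  qed
  then show ?thesis by (simp add: inner_diff_left)
qed

text \<open>The Taylor expansion is an equality, so its remainder witnesses both semijet
  inequalities, and symmetrising leaves the form unchanged.\<close>

lemma sym_part_hess_in_D2:
  assumes "x \<in> \<Omega>" "grad u x \<noteq> 0"
  shows "sym_part (hess u x) \<in> D2_plus u x" "sym_part (hess u x) \<in> D2_minus u x"
  unfolding D2_plus_def D2_minus_def semijet_plus_def semijet_minus_def
  using taylor2_C2[OF assms(1)] assms(2)
  by (auto simp: transpose_sym_part inner_sym_part_tensor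
      intro!: exI[of _ "\<lambda>z. u (z + x) - u x - grad u x \<bullet> z - 1/2 * (hess u x \<bullet> tensor z z)"])

text \<open>Product rule; the transpose enters, as \<open>v*\<close>, when the increment is moved to
  the other side of the inner product.\<close>

lemma grad_norm_square:
  assumes "x \<in> \<Omega>"
  shows "grad (\<lambda>z. (norm (grad u z))\<^sup>2) x = 2 *\<^sub>R (grad u x v* hess u x)"
proof (rule grad_eqI)
  have D: "(grad u has_derivative (\<lambda>h. hess u x *v h)) (at x)"
    using C2 assms jacobian_works unfolding C2_on_def hess_def by blast
  have "((\<lambda>z. grad u z \<bullet> grad u z) has_derivative
      (\<lambda>h. grad u x \<bullet> (hess u x *v h) + (hess u x *v h) \<bullet> grad u x)) (at x)"
    by (rule has_derivative_inner[OF D D])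
  then show "((\<lambda>z. (norm (grad u z))\<^sup>2) has_derivative
      (\<lambda>h. h \<bullet> 2 *\<^sub>R (grad u x v* hess u x))) (at x)"
    by (simp add: power2_norm_eq_inner inner_commute flip: dot_lmul_matrix)
qed

text \<open>At \<open>x\<close>, |Du + a|^2 = |Du|^2 + 2 Du . a + |a|^2 is at least |Du|^2, and
  \<open>norm_le_Linf_norm\<close> bounds this one value by the supremum even if \<open>x\<close> is
  a boundary point.\<close>

lemma Linf_norm_le_add:
  assumes S: "open S" "compactly_inside S \<Omega>" and x: "x \<in> max_set S u"
    and a: "\<And>y. grad A y = a" "0 \<le> grad u x \<bullet> a"
  shows "Linf_norm S (grad u) \<le> Linf_norm S (\<lambda>y. grad u y + grad A y)"
proof -
  have xcl: "x \<in> closure S" "Linf_norm S (grad u) = ereal (norm (grad u x))"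
    using x by (auto simp: max_set_def)
  have sub: "closure S \<subseteq> \<Omega>" using S(2) by (simp add: compactly_inside_def)
  have "(norm (grad u x))\<^sup>2 \<le> (norm (grad u x + a))\<^sup>2"
    using a(2) by (simp add: power2_norm_eq_inner inner_add_left inner_add_right inner_commute)
  then have "ereal (norm (grad u x)) \<le> ereal (norm (grad u x + a))"
    by (simp add: power2_le_iff_abs_le)
  also have "\<dots> \<le> Linf_norm S (\<lambda>y. grad u y + a)"
    using norm_le_Linf_norm[OF open_dom _ S(1) _ xcl(1), of "\<lambda>y. grad u y + a"]
      sub xcl(1) closure_subset[of S]
    by (force intro!: continuous_intros continuous_on_grad)
  finally show ?thesis by (simp add: xcl(2) a(1))
qed

text \<open>Each nonconstant case needs a nonnegative product of \<open>grad u x\<close> with the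
  variation. It is \<open>\<xi>\<close> times the form of \<open>X\<close>, with two nonnegative
  factors for \<open>aff_plus\<close> and two nonpositive ones for \<open>aff_minus\<close>; for
  \<open>aff_tangent\<close> it vanishes.\<close>

lemma infinity_harmonic_imp_le:
  assumes pde: "\<forall>x\<in>\<Omega>. tensor (grad u x) (grad u x) \<bullet> hess u x = 0"
    and S: "open S" "compactly_inside S \<Omega>"
    and A: "A \<in> aff_plus S u \<union> aff_minus S u \<union> aff_tangent S u"
  shows "Linf_norm S (grad u) \<le> Linf_norm S (\<lambda>y. grad u y + grad A y)"
proof -
  have dom: "x \<in> \<Omega>" if "x \<in> max_set S u" for x
    using that S(2) by (auto simp: max_set_def compactly_inside_def)
  have pde': "hess u x \<bullet> tensor (grad u x) (grad u x) = 0" if "x \<in> max_set S u" for x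
    using pde dom[OF that] by (simp add: inner_commute)
  consider (const) c where "A = (\<lambda>_. c)"
    | (plus) \<xi> x X where "\<xi> \<ge> 0" "x \<in> max_set S u" "X \<in> D2_plus u x"
        "\<And>y. grad A y = \<xi> *\<^sub>R (X *v grad u x)"
    | (minus) \<xi> x X where "\<xi> \<le> 0" "x \<in> max_set S u" "X \<in> D2_minus u x"
        "\<And>y. grad A y = \<xi> *\<^sub>R (X *v grad u x)"
    | (tangent) \<xi> x where "x \<in> max_set S u"
        "\<And>y. grad A y = \<xi> *\<^sub>R grad (\<lambda>z. (norm (grad u z))\<^sup>2) x"
    using A unfolding aff_plus_def aff_minus_def aff_tangent_def by blast
  then show ?thesis
  proof cases
    case const
    have "grad A y = 0" for y
      unfolding const by (rule grad_eqI) simp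
    then show ?thesis by simp
  next
    case plus
    show ?thesis
    proof (rule Linf_norm_le_add[OF S plus(2) plus(4)])
      have "0 \<le> X \<bullet> tensor (grad u x) (grad u x)"
        using D2_plus_ge_hess[OF dom[OF plus(2)] plus(3)] pde'[OF plus(2)] by metis
      then show "0 \<le> grad u x \<bullet> \<xi> *\<^sub>R (X *v grad u x)"
        using plus(1) by (simp add: inner_tensor)
    qed
  next
    case minus
    show ?thesis
    proof (rule Linf_norm_le_add[OF S minus(2) minus(4)])
      have "X \<bullet> tensor (grad u x) (grad u x) \<le> 0"
        using D2_minus_le_hess[OF dom[OF minus(2)] minus(3)] pde'[OF minus(2)] by metis
      then show "0 \<le> grad u x \<bullet> \<xi> *\<^sub>R (X *v grad u x)"
        using minus(1) by (simp add: inner_tensor mult_nonpos_nonpos)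
    qed
  next
    case tangent
    \<comment> \<open>A matrix and its transpose have the same quadratic form.\<close>
    have "grad u x \<bullet> (grad u x v* hess u x) = 0"
      using pde'[OF tangent(1)] by (metis dot_lmul_matrix inner_commute inner_tensor)
    then show ?thesis
      using Linf_norm_le_add[OF S tangent]
      by (simp add: grad_norm_square[OF dom[OF tangent(1)]])
  qed
qed

text \<open>The direction \<open>w\<close> is left general to serve both converses: it will be the
  symmetrised Hessian applied to the gradient, or the gradient of |Du|^2.\<close>

lemma decreasing_affine:
  assumes x: "x \<in> \<Omega>" and nm: "\<not> local_min_in \<Omega> (\<lambda>y. norm (grad u y)) x"
    and c: "grad u x \<bullet> w \<noteq> 0"
  obtains S \<xi> where "open S" "S \<noteq> {}" "compactly_inside S \<Omega>" "x \<in> max_set S u"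
    "\<And>A. (\<And>y. grad A y = \<xi> *\<^sub>R w) \<Longrightarrow>
      \<not> Linf_norm S (grad u) \<le> Linf_norm S (\<lambda>y. grad u y + grad A y)"
proof -
  \<comment> \<open>The sign turns the product with the gradient into minus its absolute
    value.\<close>
  define v where "v = - sgn (grad u x \<bullet> w) *\<^sub>R w"
  have "grad u x \<bullet> v < 0" using c by (simp add: v_def sgn_if)
  from Linf_norm_decrease[OF open_dom continuous_on_grad x nm this]
  obtain S s where S: "open S" "S \<noteq> {}" "compactly_inside S \<Omega>" "x \<in> closure S"
    "Linf_norm S (grad u) = ereal (norm (grad u x))"
    and less: "Linf_norm S (\<lambda>y. grad u y + s *\<^sub>R v) < ereal (norm (grad u x))" .
  show ?thesis
  proof (rule that[OF S(1-3), of "- s * sgn (grad u x \<bullet> w)"])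
    show "x \<in> max_set S u" using S(4,5) by (simp add: max_set_def)
    show "\<not> Linf_norm S (grad u) \<le> Linf_norm S (\<lambda>y. grad u y + grad A y)"
      if "\<And>y. grad A y = (- s * sgn (grad u x \<bullet> w)) *\<^sub>R w" for A
      using less S(5) that by (simp add: v_def not_le)
  qed
qed

end

section \<open>Equivalence of the PDE with both families of inequalities\<close>

theorem corollary10:
  fixes \<Omega> :: "(real^'n) set" and u :: "real^'n \<Rightarrow> real"
  assumes "open \<Omega>"
    and "C2_on \<Omega> u"
    and "\<not> (\<exists>x\<in>\<Omega>. local_min_in \<Omega> (\<lambda>y. norm (grad u y)) x)"
  shows "((\<forall>x\<in>\<Omega>. tensor (grad u x) (grad u x) \<bullet> hess u x = 0) \<longleftrightarrow>
          (\<forall>\<Omega>'. open \<Omega>' \<and> \<Omega>' \<noteq> {} \<and> compactly_inside \<Omega>' \<Omega> \<longrightarrow>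
             (\<forall>A \<in> aff_plus \<Omega>' u \<union> aff_minus \<Omega>' u.
                Linf_norm \<Omega>' (grad u) \<le> Linf_norm \<Omega>' (\<lambda>x. grad u x + grad A x)))) \<and>
         ((\<forall>x\<in>\<Omega>. tensor (grad u x) (grad u x) \<bullet> hess u x = 0) \<longleftrightarrow>
          (\<forall>\<Omega>'. open \<Omega>' \<and> \<Omega>' \<noteq> {} \<and> compactly_inside \<Omega>' \<Omega> \<longrightarrow>
             (\<forall>A \<in> aff_tangent \<Omega>' u.
                Linf_norm \<Omega>' (grad u) \<le> Linf_norm \<Omega>' (\<lambda>x. grad u x + grad A x))))"
    (is "(?pde \<longleftrightarrow> ?jets) \<and> (?pde \<longleftrightarrow> ?tangents)")
proof -
  have forward: "?pde \<Longrightarrow> ?jets" "?pde \<Longrightarrow> ?tangents"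
    using infinity_harmonic_imp_le[OF assms(1,2)] by blast+
  have nm: "\<not> local_min_in \<Omega> (\<lambda>y. norm (grad u y)) x" if "x \<in> \<Omega>" for x
    using assms(3) that by blast
  have ?pde if ?jets
  proof (rule ballI, rule ccontr)
    fix x assume x: "x \<in> \<Omega>" and "tensor (grad u x) (grad u x) \<bullet> hess u x \<noteq> 0"
    then have c: "grad u x \<bullet> (sym_part (hess u x) *v grad u x) \<noteq> 0"
      using inner_sym_part_tensor[of "hess u x" "grad u x"] by (simp add: inner_tensor inner_commute)
    \<comment> \<open>The semijets admit only nonzero first components.\<close>
    then have P: "grad u x \<noteq> 0" by auto
    from decreasing_affine[OF assms(1,2) x nm[OF x] c]
    obtain S \<xi> where S: "open S" "S \<noteq> {}" "compactly_inside S \<Omega>" "x \<in> max_set S u"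
      and bad: "\<And>A. (\<And>y. grad A y = \<xi> *\<^sub>R (sym_part (hess u x) *v grad u x)) \<Longrightarrow>
        \<not> Linf_norm S (grad u) \<le> Linf_norm S (\<lambda>y. grad u y + grad A y)" by blast
    define A where "A = (\<lambda>y. y \<bullet> \<xi> *\<^sub>R (sym_part (hess u x) *v grad u x))"
    have A: "affine_fun A" "\<And>y. grad A y = \<xi> *\<^sub>R (sym_part (hess u x) *v grad u x)"
      unfolding A_def by (rule affine_fun_inner grad_inner)+
    have "A \<in> aff_plus S u \<union> aff_minus S u"
    \<comment> \<open>The sign of \<open>\<xi>\<close> is unknown, but the symmetrised Hessian lies
      in both semijet sets, so either sign gives an admissible variation.\<close>
    proof (cases "\<xi> \<ge> 0")
      case True
      then have "A \<in> aff_plus S u"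
        using A S(4) sym_part_hess_in_D2(1)[OF assms(1,2) x P] unfolding aff_plus_def by blast
      then show ?thesis ..
    next
      case False
      then have "\<xi> \<le> 0" by simp
      then have "A \<in> aff_minus S u"
        using A S(4) sym_part_hess_in_D2(2)[OF assms(1,2) x P] unfolding aff_minus_def by blast
      then show ?thesis ..
    qed
    with that S(1-3) bad[of A, OF A(2)] show False by blast
  qed
  moreover have ?pde if ?tangents
  proof (rule ballI, rule ccontr)
    fix x assume x: "x \<in> \<Omega>" and "tensor (grad u x) (grad u x) \<bullet> hess u x \<noteq> 0"
    \<comment> \<open>By the product rule this number is twice the left-hand side of the PDE at
      \<open>x\<close>.\<close>
    then have c: "grad u x \<bullet> grad (\<lambda>z. (norm (grad u z))\<^sup>2) x \<noteq> 0"
      by (simp add: grad_norm_square[OF assms(1,2) x] inner_tensor inner_commute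
          flip: dot_lmul_matrix)
    from decreasing_affine[OF assms(1,2) x nm[OF x] c]
    obtain S \<xi> where S: "open S" "S \<noteq> {}" "compactly_inside S \<Omega>" "x \<in> max_set S u"
      and bad: "\<And>A. (\<And>y. grad A y = \<xi> *\<^sub>R grad (\<lambda>z. (norm (grad u z))\<^sup>2) x) \<Longrightarrow>
        \<not> Linf_norm S (grad u) \<le> Linf_norm S (\<lambda>y. grad u y + grad A y)" by blast
    define A where "A = (\<lambda>y. y \<bullet> \<xi> *\<^sub>R grad (\<lambda>z. (norm (grad u z))\<^sup>2) x)"
    have A: "affine_fun A" "\<And>y. grad A y = \<xi> *\<^sub>R grad (\<lambda>z. (norm (grad u z))\<^sup>2) x"
      unfolding A_def by (rule affine_fun_inner grad_inner)+
    then have "A \<in> aff_tangent S u" using S(4) unfolding aff_tangent_def by blast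
    with that S(1-3) bad[of A, OF A(2)] show False by blast
  qed
  ultimately show ?thesis using forward by blast
qed

end
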